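(* A ring $R$ is strongly periodic if and only if for any $a\in R$ there exists a potent $p\in R$ such that $a-p\in P(R)$.
   Context: All rings are associative with identity. $P(R)$ is the prime radical of $R$ (the intersection of all prime ideals). An element $p\in R$ is potent if $p=p^m$ for some integer $m\ge 2$. A ring $R$ is strongly periodic if for every $a\in R$ there exists a potent $p\in R$ such that $a-p\in P(R)$ and $ap=pa$. *)

theory Defs
  imports "HOL-Algebra.Algebra"
begin

text \<open>
  The library's \<open>primeideal\<close> extends \<open>cring\<close> and is elementwise (\<open>a \<otimes> b \<in> I\<close>), so it does not
  apply to noncommutative rings, where primeness is a condition on products of two-sided ideals.
\<close>

definition prime_ideal_nc :: "'a set \<Rightarrow> ('a, 'b) ring_scheme \<Rightarrow> bool" where
  "prime_ideal_nc P R \<longleftrightarrow>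
     ideal P R \<and> P \<noteq> carrier R \<and>
     (\<forall>I J. ideal I R \<longrightarrow> ideal J R \<longrightarrow> ideal_prod R I J \<subseteq> P \<longrightarrow> I \<subseteq> P \<or> J \<subseteq> P)"

text \<open>
  Writing the intersection as a subset of the carrier makes the empty intersection (which occurs
  only for the zero ring) equal to \<open>carrier R\<close> rather than \<open>UNIV\<close>.
\<close>

definition prime_radical :: "('a, 'b) ring_scheme \<Rightarrow> 'a set" where
  "prime_radical R = {x \<in> carrier R. \<forall>P. prime_ideal_nc P R \<longrightarrow> x \<in> P}"

definition potent :: "('a, 'b) ring_scheme \<Rightarrow> 'a \<Rightarrow> bool" where
  "potent R p \<longleftrightarrow> p \<in> carrier R \<and> (\<exists>m::nat. m \<ge> 2 \<and> p = p [^]\<^bsub>R\<^esub> m)"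

definition strongly_periodic :: "('a, 'b) ring_scheme \<Rightarrow> bool" where
  "strongly_periodic R \<longleftrightarrow>
     (\<forall>a \<in> carrier R. \<exists>p. potent R p \<and> a \<ominus>\<^bsub>R\<^esub> p \<in> prime_radical R \<and> a \<otimes>\<^bsub>R\<^esub> p = p \<otimes>\<^bsub>R\<^esub> a)"

end

theory Submission
  imports Defs
begin

text \<open>
  Suppose every element is congruent to a potent modulo \<open>P(R)\<close>. Applied to \<open>2\<close>, and since \<open>P(R)\<close>
  is nil, this gives a power of \<open>2\<^sup>m - 2\<close> that vanishes in \<open>R\<close>, so \<open>R\<close> has positive
  characteristic \<open>N\<close>. If \<open>a - p \<in> P(R)\<close> with \<open>p = p\<^sup>m\<close>, then \<open>a\<^sup>m - a\<close> is nilpotent, and in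
  characteristic \<open>N\<close> this forces \<open>a\<^sup>m\<^sup>M = a\<^sup>M\<close> for some \<open>M > 0\<close>. Hence all sufficiently high
  powers of \<open>a\<close> are potent; those with exponent \<open>1 + n(m - 1)\<close> are still congruent to \<open>a\<close>, and
  they commute with \<open>a\<close>.
\<close>

section \<open>The prime radical as a nil ideal\<close>

text \<open>Zorn's lemma, with the zero ideal as a starting member, gives an ideal maximal among
  those that miss all powers of \<open>x\<close>; maximality forces it to be prime.\<close>

lemma (in ring) prime_ideal_avoiding_powers:
  assumes x: "x \<in> carrier R" and pow: "\<And>k::nat. x [^] k \<noteq> \<zero>"
  shows "\<exists>P. prime_ideal_nc P R \<and> x \<notin> P"
proof -
  define A where "A = {I. ideal I R \<and> (\<forall>k::nat. x [^] k \<notin> I)}"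
  have "{\<zero>} \<in> A"
    using pow zeroideal by (auto simp: A_def)
  moreover have "\<Union>C \<in> A" if C: "C \<noteq> {}" "subset.chain A C" for C
  proof -
    have "subset.chain {I. ideal I R} C"
      using C unfolding A_def pred_on.chain_def by auto
    then show ?thesis
      using chain_Union_is_ideal[of C] C unfolding A_def pred_on.chain_def by auto
  qed
  ultimately have "\<exists>M\<in>A. \<forall>J\<in>A. M \<subseteq> J \<longrightarrow> J = M"
    by (intro subset_Zorn_nonempty) auto
  then obtain M where M: "M \<in> A" and max: "\<And>J. J \<in> A \<Longrightarrow> M \<subseteq> J \<Longrightarrow> J = M"
    by auto
  interpret M: ideal M R
    using M by (simp add: A_def)
  have notin: "x [^] k \<notin> M" for k :: nat
    using M by (simp add: A_def)
  have hits: "\<exists>(k::nat) u v. u \<in> M \<and> v \<in> I \<and> x [^] k = u \<oplus> v" if I: "ideal I R" "\<not> I \<subseteq> M" for I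
  proof -
    interpret I: ideal I R by fact
    have sum: "u \<oplus> v \<in> set_add R M I" if "u \<in> M" "v \<in> I" for u v
      using that unfolding set_add_def' by blast
    have "M \<subseteq> set_add R M I"
      using sum[OF _ I.zero_closed] M.Icarr by (metis r_zero subsetI)
    moreover have "I \<subseteq> set_add R M I"
      using sum[OF M.zero_closed] I.Icarr by (metis l_zero subsetI)
    moreover have "ideal (set_add R M I) R"
      using I add_ideals M.ideal_axioms by blast
    \<comment> \<open>The sum is an ideal strictly larger than \<open>M\<close>, so by maximality it
      is outside \<open>A\<close>, which for an ideal means that it contains a power of
      \<open>x\<close>.\<close>
    ultimately have "\<exists>k::nat. x [^] k \<in> set_add R M I"
      using max I unfolding A_def by blast
    then show ?thesis
      by (auto simp: set_add_def')
  qed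
  have "prime_ideal_nc M R"
    unfolding prime_ideal_nc_def
  proof (intro conjI allI impI)
    show "ideal M R" by (rule M.ideal_axioms)
    show "M \<noteq> carrier R"
      using notin[of 0] by auto
    fix I J assume I: "ideal I R" and J: "ideal J R" and IJ: "ideal_prod R I J \<subseteq> M"
    show "I \<subseteq> M \<or> J \<subseteq> M"
    proof (rule ccontr)
      assume "\<not> (I \<subseteq> M \<or> J \<subseteq> M)"
      then obtain k l :: nat and u v u' v' where
        uv: "u \<in> M" "v \<in> I" "x [^] k = u \<oplus> v" and
        uv': "u' \<in> M" "v' \<in> J" "x [^] l = u' \<oplus> v'"
        using hits[OF I] hits[OF J] by metis
      have carr: "u \<in> carrier R" "v \<in> carrier R" "u' \<in> carrier R" "v' \<in> carrier R"
        using uv uv' M.Icarr ideal.Icarr[OF I] ideal.Icarr[OF J] by auto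
      have "x [^] (k + l) = (u \<oplus> v) \<otimes> (u' \<oplus> v')"
        using x uv(3) uv'(3) by (simp flip: nat_pow_mult)
      \<comment> \<open>The first two summands have a factor in \<open>M\<close>; the last,
        \<open>v \<otimes> v'\<close>, lies in the product of \<open>I\<close> and
        \<open>J\<close>.\<close>
      also have "\<dots> = u \<otimes> (u' \<oplus> v') \<oplus> (v \<otimes> u' \<oplus> v \<otimes> v')"
        using carr by (simp add: l_distr r_distr a_ac)
      also have "\<dots> \<in> M"
        using uv uv' carr IJ ideal_prod.prod[of v I v' J R]
        by (intro additive_subgroup.a_closed[OF M.is_additive_subgroup]) (auto intro: M.I_l_closed M.I_r_closed)
      finally show False
        using notin by blast
    qed
  qed
  then show ?thesis
    using notin[of 1] x by auto
qed

lemma (in ring) prime_radical_nil: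
  assumes "x \<in> prime_radical R"
  shows "\<exists>k::nat. x [^] k = \<zero>"
  using assms prime_ideal_avoiding_powers[of x] by (auto simp: prime_radical_def)

lemma (in ring) prime_radical_ideal: "ideal (prime_radical R) R"
proof -
  \<comment> \<open>Inserting \<open>carrier R\<close> keeps the family nonempty even for the zero
    ring, which has no prime ideals.\<close>
  have "prime_radical R = \<Inter>(insert (carrier R) {P. prime_ideal_nc P R})"
    by (auto simp: prime_radical_def)
  moreover have "ideal \<dots> R"
    by (rule i_Intersect) (auto simp: prime_ideal_nc_def oneideal)
  ultimately show ?thesis by simp
qed

section \<open>Congruences and identities for powers\<close>

lemma (in ideal) pow_diff_mem:
  assumes a: "a \<in> carrier R" and b: "b \<in> carrier R" and d: "a \<ominus> b \<in> I"
  shows "a [^] (n::nat) \<ominus> b [^] n \<in> I"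
proof (induction n)
  case 0
  then show ?case
    by (simp add: minus_eq r_neg)
next
  case (Suc n)
  \<comment> \<open>This telescoping respects the order of the factors, so it holds even if
    \<open>a\<close> and \<open>b\<close> do not commute.\<close>
  have "a [^] Suc n \<ominus> b [^] Suc n = a [^] n \<otimes> (a \<ominus> b) \<oplus> (a [^] n \<ominus> b [^] n) \<otimes> b"
    using nat_pow_closed[OF a, of n] nat_pow_closed[OF b, of n] a b
    by (simp del: nat_pow_closed, algebra)
  also have "\<dots> \<in> I"
    using a b d Suc by (intro additive_subgroup.a_closed[OF is_additive_subgroup] I_l_closed I_r_closed) auto
  finally show ?case .
qed

lemma (in ideal) diff_mem_trans:
  assumes "a \<in> carrier R" "b \<in> carrier R" "c \<in> carrier R" "a \<ominus> c \<in> I" "b \<ominus> c \<in> I"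
  shows "a \<ominus> b \<in> I"
proof -
  have "a \<ominus> b = (a \<ominus> c) \<oplus> \<ominus> (b \<ominus> c)"
    using assms(1-3) by algebra
  then show ?thesis
    using assms(4,5) by (simp add: a_closed a_inv_closed)
qed

text \<open>Multiplying by \<open>p [^] d\<close> fixes \<open>p\<close>. This lets the exponent
  grow through the numbers congruent to 1 modulo \<open>d\<close> while staying congruent to the
  given potent.\<close>

lemma (in monoid) pow_eq_self_iterate:
  assumes "p \<in> carrier G" "p = p [^] Suc d"
  shows "p [^] Suc (n * d) = p"
proof (induction n)
  case (Suc n)
  have "p [^] Suc (Suc n * d) = p [^] Suc (n * d) \<otimes> p [^] d"
    using assms(1) nat_pow_mult[of p "Suc (n * d)" d] by (simp add: add.commute)
  also have "\<dots> = p [^] Suc d"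
    using Suc assms(1) nat_pow_Suc2[of p d] by simp
  finally show ?case
    using assms(2) by simp
qed (use assms in simp)

lemma (in ring) add_pow_one_pow:
  "(add_pow R (n::nat) \<one>) [^] (k::nat) = add_pow R (n ^ k) \<one>"
proof (induction k)
  case 0
  then show ?case
    by (simp add: add_pow_def)
next
  case (Suc k)
  then show ?case
    by (simp add: add_pow_ldistr add.nat_pow_pow mult.commute)
qed

section \<open>Nilpotent perturbations in positive characteristic\<close>

text \<open>The binomial theorem cut off after the linear term. If \<open>Suc n\<close> is a
  multiple of the characteristic, the linear term vanishes and only the quadratic error
  remains.\<close>

lemma (in cring) pow_add_mod_square:
  assumes "c \<in> carrier R" "d \<in> carrier R"
  shows "\<exists>w \<in> carrier R. (c \<oplus> d) [^] Suc n
           = c [^] Suc n \<oplus> add_pow R (Suc n) (c [^] n \<otimes> d) \<oplus> (d \<otimes> d) \<otimes> w"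
proof (induction n)
  case 0
  show ?case
    using assms by (intro bexI[of _ \<zero>]) auto
next
  case (Suc n)
  then obtain w where w: "w \<in> carrier R" and
    eq: "(c \<oplus> d) [^] Suc n = c [^] Suc n \<oplus> add_pow R (Suc n) (c [^] n \<otimes> d) \<oplus> (d \<otimes> d) \<otimes> w"
    by blast
  define u where "u = c [^] n"
  define s where "s = add_pow R (Suc n) u"
  have carr: "u \<in> carrier R" "s \<in> carrier R"
    using assms by (auto simp: u_def s_def)
  have s1: "add_pow R (Suc n) (c [^] n \<otimes> d) = s \<otimes> d"
    using assms carr by (simp only: s_def u_def add_pow_ldistr nat_pow_closed)
  have s2: "add_pow R (Suc (Suc n)) (c [^] Suc n \<otimes> d) = s \<otimes> c \<otimes> d \<oplus> u \<otimes> c \<otimes> d"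
    using assms carr by (simp add: s_def u_def add_pow_ldistr l_distr)
  have "(c \<oplus> d) [^] Suc (Suc n) = (u \<otimes> c \<oplus> s \<otimes> d \<oplus> (d \<otimes> d) \<otimes> w) \<otimes> (c \<oplus> d)"
    using eq s1 by (simp add: u_def)
  also have "\<dots> = u \<otimes> c \<otimes> c \<oplus> (s \<otimes> c \<otimes> d \<oplus> u \<otimes> c \<otimes> d) \<oplus> (d \<otimes> d) \<otimes> (s \<oplus> w \<otimes> (c \<oplus> d))"
    using assms carr w by algebra
  finally have "(c \<oplus> d) [^] Suc (Suc n) = c [^] Suc (Suc n) \<oplus> add_pow R (Suc (Suc n)) (c [^] Suc n \<otimes> d)
      \<oplus> (d \<otimes> d) \<otimes> (s \<oplus> w \<otimes> (c \<oplus> d))"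
    using s2 by (simp add: u_def)
  then show ?case
    using assms carr w by blast
qed

text \<open>Each further \<open>N\<close>-th power kills the linear term and squares the error, so
  the power of \<open>d\<close> dividing the error rises until it vanishes.\<close>

lemma (in cring) pow_eq_of_nilpotent_diff:
  fixes N k :: nat
  assumes c: "c \<in> carrier R" and d: "d \<in> carrier R"
    and N: "N > 0" "add_pow R N \<one> = \<zero>" and nil: "d [^] k = \<zero>"
  shows "\<exists>M::nat. M > 0 \<and> (c \<oplus> d) [^] M = c [^] M"
proof -
  have char: "add_pow R N y = \<zero>" if "y \<in> carrier R" for y
    using that N add_pow_ldistr[of \<one> y N] by simp
  obtain N' where N': "N = Suc N'"
    using N by (cases N) auto
  \<comment> \<open>The exponent starts at 1, since squaring an error divisible only by
    \<open>d [^] 0\<close> would gain nothing; from \<open>Suc L\<close> on, squaring gains at least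
    one factor \<open>d\<close>.\<close>
  have "\<exists>M::nat. M > 0 \<and> (\<exists>w \<in> carrier R. (c \<oplus> d) [^] M = c [^] M \<oplus> d [^] Suc L \<otimes> w)" for L
  proof (induction L)
    case 0
    then show ?case
      using c d by (intro exI[of _ 1] conjI bexI[of _ \<one>]) auto
  next
    case (Suc L)
    then obtain M :: nat and w where Mw: "M > 0" "w \<in> carrier R"
      "(c \<oplus> d) [^] M = c [^] M \<oplus> d [^] Suc L \<otimes> w"
      by blast
    define e where "e = d [^] Suc L \<otimes> w"
    have e: "e \<in> carrier R"
      using d Mw by (simp add: e_def)
    obtain v where v: "v \<in> carrier R" and
      "(c [^] M \<oplus> e) [^] N = (c [^] M) [^] N \<oplus> add_pow R N ((c [^] M) [^] N' \<otimes> e) \<oplus> (e \<otimes> e) \<otimes> v"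
      using pow_add_mod_square[of "c [^] M" e N'] c e unfolding N' by blast
    then have "(c \<oplus> d) [^] (M * N) = c [^] (M * N) \<oplus> (e \<otimes> e) \<otimes> v"
      using c d e Mw char by (simp add: e_def nat_pow_pow[symmetric])
    also have "(e \<otimes> e) \<otimes> v = d [^] Suc (Suc L) \<otimes> (d [^] L \<otimes> w \<otimes> w \<otimes> v)"
    proof -
      define f where "f = d [^] L"
      have "f \<in> carrier R"
        using d by (simp add: f_def)
      then have "(f \<otimes> d \<otimes> w \<otimes> (f \<otimes> d \<otimes> w)) \<otimes> v = f \<otimes> d \<otimes> d \<otimes> (f \<otimes> w \<otimes> w \<otimes> v)"
        using d Mw(2) v by algebra
      then show ?thesis
        by (simp add: e_def f_def)
    qed
    finally show ?case
      using c d Mw N v by (intro exI[of _ "M * N"]) auto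
  qed
  from this[of k] obtain M :: nat and w where "M > 0" "w \<in> carrier R"
    "(c \<oplus> d) [^] M = c [^] M \<oplus> d [^] Suc k \<otimes> w"
    by blast
  then show ?thesis
    using nil c d by auto
qed

section \<open>Centralizers and reduction to a commutative subring\<close>

definition centralizer :: "('a, 'b) ring_scheme \<Rightarrow> 'a set \<Rightarrow> 'a set" where
  "centralizer R S = {x \<in> carrier R. \<forall>s \<in> S. x \<otimes>\<^bsub>R\<^esub> s = s \<otimes>\<^bsub>R\<^esub> x}"

lemma (in ring) centralizer_subring:
  assumes "S \<subseteq> carrier R"
  shows "subring (centralizer R S) R"
proof (rule subringI)
  fix h1 h2 assume h: "h1 \<in> centralizer R S" "h2 \<in> centralizer R S"
  have "(h1 \<otimes> h2) \<otimes> s = s \<otimes> (h1 \<otimes> h2)" if "s \<in> S" for s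
  proof -
    have "h1 \<in> carrier R" "h2 \<in> carrier R" "s \<in> carrier R" "h1 \<otimes> s = s \<otimes> h1" "h2 \<otimes> s = s \<otimes> h2"
      using h that assms by (auto simp: centralizer_def)
    then show ?thesis
      by (metis m_assoc)
  qed
  then show "h1 \<otimes> h2 \<in> centralizer R S"
    using h by (auto simp: centralizer_def)
  show "h1 \<oplus> h2 \<in> centralizer R S"
    using h assms by (auto simp: centralizer_def l_distr r_distr subset_iff)
qed (use assms in \<open>auto simp: centralizer_def l_minus r_minus subset_iff\<close>)

lemma (in ring) pow_eq_of_commuting_nilpotent_diff:
  fixes N k :: nat
  assumes c: "c \<in> carrier R" and d: "d \<in> carrier R" and comm: "c \<otimes> d = d \<otimes> c"
    and N: "N > 0" "add_pow R N \<one> = \<zero>" and nil: "d [^] k = \<zero>"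
  shows "\<exists>M::nat. M > 0 \<and> (c \<oplus> d) [^] M = c [^] M"
proof -
  \<comment> \<open>The double centralizer of \<open>{c, d}\<close> is a commutative subring containing \<open>c\<close> and \<open>d\<close>.\<close>
  define Z where "Z = centralizer R {c, d}"
  define H where "H = centralizer R Z"
  have Z: "c \<in> Z" "d \<in> Z" "Z \<subseteq> carrier R"
    using c d comm by (auto simp: Z_def centralizer_def)
  \<comment> \<open>Since \<open>c\<close> and \<open>d\<close> lie in \<open>Z\<close>, whatever
    commutes with \<open>Z\<close> commutes with both. The resulting inclusion of \<open>H\<close>
    in \<open>Z\<close> makes \<open>H\<close> commutative.\<close>
  have H: "c \<in> H" "d \<in> H" "H \<subseteq> Z"
    using c d Z by (auto simp: Z_def H_def centralizer_def)
  have "subcring H R"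
  proof (rule subcringI)
    show "subring H R"
      unfolding H_def using Z by (intro centralizer_subring)
  qed (use H in \<open>auto simp: H_def centralizer_def\<close>)
  then interpret S: cring "R\<lparr>carrier := H\<rparr>"
    using subcring_iff H Z by blast
  have pow: "x [^]\<^bsub>R\<lparr>carrier := H\<rparr>\<^esub> n = x [^] n" for x and n :: nat
    by (rule nat_pow_consistent[symmetric])
  have "add_pow (R\<lparr>carrier := H\<rparr>) N \<one> = \<zero>"
    using N(2) by (simp add: add_pow_def nat_pow_def)
  then have "\<exists>M::nat. M > 0 \<and> (c \<oplus> d) [^]\<^bsub>R\<lparr>carrier := H\<rparr>\<^esub> M = c [^]\<^bsub>R\<lparr>carrier := H\<rparr>\<^esub> M"
    using S.pow_eq_of_nilpotent_diff[of c d N k] H(1,2) N(1) nil by (simp add: pow)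
  then show ?thesis
    unfolding pow .
qed

section \<open>Positive characteristic and the commuting potent\<close>

lemma (in ideal) pow_diff_self_mem:
  assumes "a \<in> carrier R" "p \<in> carrier R" "a \<ominus> p \<in> I" "p [^] (m::nat) = p"
  shows "a [^] m \<ominus> a \<in> I"
  using assms pow_diff_mem[of a p m] diff_mem_trans[of "a [^] m" a p] by simp

lemma (in ring) positive_characteristic:
  assumes two: "potent R p" "add_pow R (2::nat) \<one> \<ominus> p \<in> prime_radical R"
  shows "\<exists>N::nat. N > 0 \<and> add_pow R N \<one> = \<zero>"
proof -
  interpret P: ideal "prime_radical R" R
    by (rule prime_radical_ideal)
  define t where "t = add_pow R (2::nat) \<one>"
  have t: "t \<in> carrier R"
    by (simp add: t_def)
  obtain m :: nat where m: "m \<ge> 2" "p [^] m = p" "p \<in> carrier R"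
    using two unfolding potent_def by metis
  \<comment> \<open>Here \<open>m \<ge> 2\<close> enters: the integer \<open>2 ^ m - 2\<close> is
    positive, hence so is its \<open>k\<close>-th power, which serves as \<open>N\<close>.\<close>
  have le: "(2::nat) < 2 ^ m"
    using m(1) power_strict_increasing[of 1 m "2::nat"] by simp
  define y where "y = add_pow R (2 ^ m - 2 :: nat) \<one>"
  have y: "y \<in> carrier R"
    by (simp add: y_def)
  have "y \<oplus> t = add_pow R (2 ^ m - 2 + 2 :: nat) \<one>"
    unfolding y_def t_def by (rule add.nat_pow_mult) simp
  also have "\<dots> = t [^] m"
    using le by (simp only: t_def add_pow_one_pow le_add_diff_inverse2 less_imp_le)
  finally have "t [^] m \<ominus> t = (y \<oplus> t) \<ominus> t"
    by simp
  also have "\<dots> = y"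
    using t y by algebra
  finally have "y = t [^] m \<ominus> t"
    by (rule sym)
  then have "y \<in> prime_radical R"
    using P.pow_diff_self_mem[of t p m] t m two by (simp add: t_def)
  then obtain k :: nat where "y [^] k = \<zero>"
    using prime_radical_nil by blast
  then show ?thesis
    unfolding y_def add_pow_one_pow using le zero_less_diff zero_less_power by blast
qed

text \<open>From exponent \<open>M\<close> on, the powers of \<open>a\<close> have period
  \<open>M * d\<close>. The exponent \<open>Suc (M * d)\<close> lies in this range, and its square
  exceeds it by a multiple of the period.\<close>

lemma (in ring) potent_pow:
  fixes M d :: nat
  assumes a: "a \<in> carrier R" and "M > 0" "d > 0" and eq: "a [^] (Suc d * M) = a [^] M"
  shows "potent R (a [^] Suc (M * d))"
proof -
  have per: "a [^] (i + r * (M * d)) = a [^] i" if "i \<ge> M" for i r :: nat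
  proof (induction r)
    case (Suc r)
    define l where "l = i - M + r * (M * d)"
    have "i + Suc r * (M * d) = l + Suc d * M" "i + r * (M * d) = l + M"
      using that by (simp_all add: l_def algebra_simps)
    moreover have "a [^] (l + Suc d * M) = a [^] (l + M)"
      by (simp only: nat_pow_mult[OF a, symmetric] eq)
    ultimately show ?case
      using Suc by (simp only:)
  qed simp
  have "Suc (M * d) \<ge> M"
    using \<open>d > 0\<close> by (cases d) auto
  then have "a [^] Suc (M * d) = a [^] (Suc (M * d) + Suc (M * d) * (M * d))"
    using per[of "Suc (M * d)" "Suc (M * d)"] by simp
  also have "\<dots> = (a [^] Suc (M * d)) [^] Suc (M * d)"
    using a nat_pow_pow[of a "Suc (M * d)" "Suc (M * d)"] by (simp only: mult_Suc_right)
  finally show ?thesis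
    using assms unfolding potent_def by (intro conjI exI[of _ "Suc (M * d)"]) auto
qed

lemma (in ring) commuting_potent:
  fixes N :: nat
  assumes N: "N > 0" "add_pow R N \<one> = \<zero>"
    and a: "a \<in> carrier R" and p: "potent R p" "a \<ominus> p \<in> prime_radical R"
  shows "\<exists>q. potent R q \<and> a \<ominus> q \<in> prime_radical R \<and> a \<otimes> q = q \<otimes> a"
proof -
  interpret P: ideal "prime_radical R" R
    by (rule prime_radical_ideal)
  obtain m :: nat where m: "m \<ge> 2" "p [^] m = p" "p \<in> carrier R"
    using p unfolding potent_def by metis
  then obtain d where d: "m = Suc d" "d > 0"
    by (cases m) auto
  \<comment> \<open>Unlike \<open>a \<ominus> p\<close>, which is nilpotent too, this difference is
    a polynomial in \<open>a\<close> and so commutes with \<open>a\<close>.\<close>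
  define x where "x = a [^] m \<ominus> a"
  have x: "x \<in> carrier R"
    using a by (simp add: x_def)
  have "x \<in> prime_radical R"
    using P.pow_diff_self_mem[of a p m] a m p by (simp add: x_def)
  then obtain k :: nat where k: "x [^] k = \<zero>"
    using prime_radical_nil by blast
  have am: "a \<oplus> x = a [^] m"
  proof -
    have "a \<oplus> (b \<ominus> a) = b" if "b \<in> carrier R" for b
      using a that by algebra
    then show ?thesis
      unfolding x_def using a by blast
  qed
  have "a \<otimes> a [^] m = a [^] m \<otimes> a"
    using a nat_pow_Suc2[of a m] by simp
  then have "a \<otimes> x = x \<otimes> a"
    using a by (simp add: x_def minus_eq l_distr r_distr l_minus r_minus)
  then obtain M :: nat where M: "M > 0" "(a \<oplus> x) [^] M = a [^] M"
    using pow_eq_of_commuting_nilpotent_diff[OF a x _ N k] by blast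
  \<comment> \<open>The exponent meets two demands: it makes the power potent, and being 1 modulo
    \<open>d\<close> it fixes \<open>p\<close>, so \<open>q\<close> stays congruent to
    \<open>p\<close> and hence to \<open>a\<close>.\<close>
  define q where "q = a [^] Suc (M * d)"
  have "potent R q"
  proof -
    have "a [^] (Suc d * M) = a [^] M"
      using nat_pow_pow[OF a, of m M] M(2) am d(1) by simp
    then show ?thesis
      unfolding q_def by (intro potent_pow a M(1) d(2))
  qed
  moreover have "a \<ominus> q \<in> prime_radical R"
  proof -
    have "p [^] Suc (M * d) = p"
      using m d by (intro pow_eq_self_iterate) auto
    then have "q \<ominus> p \<in> prime_radical R"
      using P.pow_diff_mem[of a p "Suc (M * d)"] a m p by (simp add: q_def del: nat_pow_Suc)
    then show ?thesis
      using P.diff_mem_trans[of a q p] a m p by (simp add: q_def)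
  qed
  moreover have "a \<otimes> q = q \<otimes> a"
    using nat_pow_Suc2[OF a, of "Suc (M * d)"] nat_pow_Suc[of a "Suc (M * d)"] by (simp only: q_def)
  ultimately show ?thesis by blast
qed

theorem corollary3p2:
  fixes R :: "('a, 'b) ring_scheme" (structure)
  assumes "ring R"
  shows "strongly_periodic R \<longleftrightarrow>
    (\<forall>a \<in> carrier R. \<exists>p. potent R p \<and> a \<ominus> p \<in> prime_radical R)"
proof
  interpret ring R by fact
  assume *: "\<forall>a \<in> carrier R. \<exists>p. potent R p \<and> a \<ominus> p \<in> prime_radical R"
  moreover have "add_pow R (2::nat) \<one> \<in> carrier R"
    by simp
  ultimately obtain N :: nat where N: "N > 0" "add_pow R N \<one> = \<zero>"
    using positive_characteristic by blast
  show "strongly_periodic R"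
    unfolding strongly_periodic_def
  proof
    fix a assume a: "a \<in> carrier R"
    with * obtain p where "potent R p" "a \<ominus> p \<in> prime_radical R"
      by blast
    then show "\<exists>q. potent R q \<and> a \<ominus> q \<in> prime_radical R \<and> a \<otimes> q = q \<otimes> a"
      by (rule commuting_potent[OF N a])
  qed
next
  assume "strongly_periodic R"
  then show "\<forall>a \<in> carrier R. \<exists>p. potent R p \<and> a \<ominus> p \<in> prime_radical R"
    unfolding strongly_periodic_def by meson
qed

end
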